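(* Let $(\mathbf{x}_t,\mathbf{z}_t,\mathbf{y}_t)_{t\ge1}$ be generated by OADM (defined in the context) with constant parameters $\eta,\rho$, and let the assumptions (a)–(e) of the context hold. Given the horizon $T\ge1$, set $\eta=\frac{G_f\sqrt{T}}{D_{\mathbf{x}}\sqrt{2\alpha}}$ and $\rho=\sqrt{T}$. Then $$R_1(T)\le\frac{\lambda_{\max}^{B}D_{\mathbf{z}}^2\sqrt{T}}{2}+\frac{\sqrt{2}\,G_fD_{\mathbf{x}}\sqrt{T}}{\sqrt{\alpha}},$$ $$R^c(T)\le\lambda_{\max}^{B}D_{\mathbf{z}}^2+\frac{2\sqrt{2}\,D_{\mathbf{x}}G_f}{\sqrt{\alpha}}+2F\sqrt{T},$$ where $$R_1(T)=\sum_{t=1}^T\big(f_t(\mathbf{x}_t)+g(\mathbf{z}_t)\big)-\min_{(\mathbf{x},\mathbf{z})\in\mathcal{X}\times\mathcal{Z},\,A\mathbf{x}+B\mathbf{z}=\mathbf{c}}\sum_{t=1}^T\big(f_t(\mathbf{x})+g(\mathbf{z})\big),$$ $$R^c(T)=\sum_{t=1}^T\Big(\|A\mathbf{x}_{t+1}+B\mathbf{z}_{t+1}-\mathbf{c}\|_2^2+\|B\mathbf{z}_{t+1}-B\mathbf{z}_t\|_2^2\Big),$$ and $\lambda_{\max}^{B}$ is the largest eigenvalue of $B^TB$.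
   Context: Setting: $\mathcal{X}\subset\mathbb{R}^{n_1}$, $\mathcal{Z}\subset\mathbb{R}^{n_2}$ are convex sets, $A\in\mathbb{R}^{m\times n_1}$, $B\in\mathbb{R}^{m\times n_2}$, $\mathbf{c}\in\mathbb{R}^m$ are fixed, $f_1,f_2,\dots:\mathbb{R}^{n_1}\to\mathbb{R}$ are convex and $g:\mathbb{R}^{n_2}\to\mathbb{R}\cup\{+\infty\}$ is closed, proper, convex. A pair $(\mathbf{x}^*,\mathbf{z}^* )\in\mathcal{X}\times\mathcal{Z}$ is feasible if $A\mathbf{x}^*+B\mathbf{z}^*=\mathbf{c}$; feasible pairs exist. The Bregman divergence of a continuously differentiable, strictly convex function $\phi$ is $B_\phi(\mathbf{u},\mathbf{v})=\phi(\mathbf{u})-\phi(\mathbf{v})-\langle\nabla\phi(\mathbf{v}),\mathbf{u}-\mathbf{v}\rangle$ (with $\mathbf{v}$ in the relative interior of the domain of $\phi$, a convex set containing $\mathcal{X}$). OADM with parameters $\rho>0$, $\eta\ge0$: for $t\ge1$, $$\mathbf{x}_{t+1}\in\operatorname{argmin}_{\mathbf{x}\in\mathcal{X}}\{f_t(\mathbf{x})+\langle\mathbf{y}_t,A\mathbf{x}+B\mathbf{z}_t-\mathbf{c}\rangle+\tfrac{\rho}{2}\|A\mathbf{x}+B\mathbf{z}_t-\mathbf{c}\|_2^2+\eta B_\phi(\mathbf{x},\mathbf{x}_t)\},$$ $$\mathbf{z}_{t+1}\in\operatorname{argmin}_{\mathbf{z}\in\mathcal{Z}}\{g(\mathbf{z})+\langle\mathbf{y}_t,A\mathbf{x}_{t+1}+B\mathbf{z}-\mathbf{c}\rangle+\tfrac{\rho}{2}\|A\mathbf{x}_{t+1}+B\mathbf{z}-\mathbf{c}\|_2^2\},$$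 $$\mathbf{y}_{t+1}=\mathbf{y}_t+\rho(A\mathbf{x}_{t+1}+B\mathbf{z}_{t+1}-\mathbf{c}),$$ the minimizers being assumed to exist. Assumptions. (a) For a $p$-norm $\|\cdot\|_p$ and $\frac1p+\frac1q=1$: $\|f_t'(\mathbf{x})\|_q\le G_f$ for every $t$, $\mathbf{x}\in\mathcal{X}$, $f_t'(\mathbf{x})\in\partial f_t(\mathbf{x})$. (b) $\phi$ is $\alpha$-strongly convex with respect to $\|\cdot\|_p$, i.e. $B_\phi(\mathbf{u},\mathbf{v})\ge\frac{\alpha}{2}\|\mathbf{u}-\mathbf{v}\|_p^2$, with $\alpha>0$. (c) $\mathbf{x}_1=\mathbf{0}\in\mathcal X$, $\mathbf{y}_1=\mathbf{0}$, $\mathbf{z}_1=\mathbf{0}\in\mathcal Z$, and every feasible pair $(\mathbf{x}^*,\mathbf{z}^* )$ satisfies $B_\phi(\mathbf{x}^*,\mathbf{x}_1)\le D_{\mathbf{x}}^2$ and $\|\mathbf{z}^*-\mathbf{z}_1\|_2\le D_{\mathbf{z}}$. (d) $g(\mathbf{z}_1)=0$ and $g(\mathbf{z})\ge0$ for all $\mathbf{z}$. (e) There is a constant $F>0$ such that $f_t(\mathbf{x}_{t+1})+g(\mathbf{z}_{t+1})-(f_t(\mathbf{x}^* )+g(\mathbf{z}^* ))\ge-F$ for every $t$ and every feasible $(\mathbf{x}^*,\mathbf{z}^* )$. The constants $G_f,D_{\mathbf x},D_{\mathbf z}$ are positive. *)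

theory Defs
  imports "HOL-Analysis.Analysis"
begin

(* The exponent ranges over [1, \<infinity>]. *)
definition pnorm :: "ereal \<Rightarrow> real ^ 'n \<Rightarrow> real" where
  "pnorm p x = (if p = \<infinity> then infnorm x
     else (\<Sum>i\<in>UNIV. \<bar>x $ i\<bar> powr real_of_ereal p) powr (1 / real_of_ereal p))"

definition conjugate_exponents :: "ereal \<Rightarrow> ereal \<Rightarrow> bool" where
  "conjugate_exponents p q \<longleftrightarrow> 1 \<le> p \<and> 1 \<le> q \<and> 1 / p + 1 / q = 1"

definition strictly_convex_on :: "'a::real_vector set \<Rightarrow> ('a \<Rightarrow> real) \<Rightarrow> bool" where
  "strictly_convex_on S f \<longleftrightarrow> convex S \<and>
     (\<forall>x\<in>S. \<forall>y\<in>S. x \<noteq> y \<longrightarrow> (\<forall>u>0. \<forall>v>0. u + v = 1 \<longrightarrow>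
        f (u *\<^sub>R x + v *\<^sub>R y) < u * f x + v * f y))"

definition subdifferential :: "('a::real_inner \<Rightarrow> real) \<Rightarrow> 'a \<Rightarrow> 'a set" where
  "subdifferential f x = {s. \<forall>y. f y \<ge> f x + s \<bullet> (y - x)}"

definition ereal_epigraph :: "('a \<Rightarrow> ereal) \<Rightarrow> ('a \<times> real) set" where
  "ereal_epigraph g = {(z, r). g z \<le> ereal r}"

definition closed_proper_convex :: "('a::real_normed_vector \<Rightarrow> ereal) \<Rightarrow> bool" where
  "closed_proper_convex g \<longleftrightarrow>
     closed (ereal_epigraph g) \<and> convex (ereal_epigraph g) \<and>
     (\<forall>z. g z \<noteq> -\<infinity>) \<and> (\<exists>z. g z \<noteq> \<infinity>)"

(* \<phi> has domain \<Omega>, and \<phi>' is its gradient on the relative interior of \<Omega>. If \<Omega> is not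
   full-dimensional, \<phi>' v is determined only up to vectors orthogonal to the affine hull
   of \<Omega>; the Bregman divergence below does not depend on this choice for u \<in> \<Omega>. *)
definition bregman_generator ::
    "'a::euclidean_space set \<Rightarrow> ('a \<Rightarrow> real) \<Rightarrow> ('a \<Rightarrow> 'a) \<Rightarrow> bool" where
  "bregman_generator \<Omega> \<phi> \<phi>' \<longleftrightarrow>
     strictly_convex_on \<Omega> \<phi> \<and>
     (\<forall>v\<in>rel_interior \<Omega>. (\<phi> has_derivative (\<lambda>h. \<phi>' v \<bullet> h)) (at v within \<Omega>)) \<and>
     continuous_on (rel_interior \<Omega>) \<phi>'"

definition bregman ::
    "('a::real_inner \<Rightarrow> real) \<Rightarrow> ('a \<Rightarrow> 'a) \<Rightarrow> 'a \<Rightarrow> 'a \<Rightarrow> real" where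
  "bregman \<phi> \<phi>' u v = \<phi> u - \<phi> v - \<phi>' v \<bullet> (u - v)"

definition residual ::
    "real ^ 'n1 ^ 'm \<Rightarrow> real ^ 'n2 ^ 'm \<Rightarrow> real ^ 'm \<Rightarrow> real ^ 'n1 \<Rightarrow> real ^ 'n2 \<Rightarrow> real ^ 'm" where
  "residual A B c u v = A *v u + B *v v - c"

definition feasible ::
    "(real ^ 'n1) set \<Rightarrow> (real ^ 'n2) set \<Rightarrow> real ^ 'n1 ^ 'm \<Rightarrow> real ^ 'n2 ^ 'm \<Rightarrow> real ^ 'm
      \<Rightarrow> ((real ^ 'n1) \<times> (real ^ 'n2)) set" where
  "feasible X Z A B c = {(u, v). u \<in> X \<and> v \<in> Z \<and> A *v u + B *v v = c}"

(* Indices start at 1; the values at index 0 are irrelevant. The membership of x t in the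
   relative interior of \<Omega> makes the divergence in the x-update well defined. *)
definition OADM ::
    "(real ^ 'n1) set \<Rightarrow> (real ^ 'n2) set \<Rightarrow> real ^ 'n1 ^ 'm \<Rightarrow> real ^ 'n2 ^ 'm \<Rightarrow> real ^ 'm
      \<Rightarrow> (nat \<Rightarrow> real ^ 'n1 \<Rightarrow> real) \<Rightarrow> (real ^ 'n2 \<Rightarrow> ereal)
      \<Rightarrow> (real ^ 'n1) set \<Rightarrow> (real ^ 'n1 \<Rightarrow> real) \<Rightarrow> (real ^ 'n1 \<Rightarrow> real ^ 'n1)
      \<Rightarrow> real \<Rightarrow> real
      \<Rightarrow> (nat \<Rightarrow> real ^ 'n1) \<Rightarrow> (nat \<Rightarrow> real ^ 'n2) \<Rightarrow> (nat \<Rightarrow> real ^ 'm) \<Rightarrow> bool" where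
  "OADM X Z A B c f g \<Omega> \<phi> \<phi>' \<rho> \<eta> x z y \<longleftrightarrow>
     (\<forall>t\<ge>1.
        x t \<in> rel_interior \<Omega> \<and>
        is_arg_min
          (\<lambda>u. f t u + y t \<bullet> residual A B c u (z t)
             + \<rho> / 2 * (norm (residual A B c u (z t)))\<^sup>2 + \<eta> * bregman \<phi> \<phi>' u (x t))
          (\<lambda>u. u \<in> X) (x (t + 1)) \<and>
        is_arg_min
          (\<lambda>v. g v + ereal (y t \<bullet> residual A B c (x (t + 1)) v
             + \<rho> / 2 * (norm (residual A B c (x (t + 1)) v))\<^sup>2))
          (\<lambda>v. v \<in> Z) (z (t + 1)) \<and>
        y (t + 1) = y t + \<rho> *\<^sub>R residual A B c (x (t + 1)) (z (t + 1)))"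

(* The minimum is rendered as an infimum, so it need not be attained. *)
definition regret1 ::
    "(real ^ 'n1) set \<Rightarrow> (real ^ 'n2) set \<Rightarrow> real ^ 'n1 ^ 'm \<Rightarrow> real ^ 'n2 ^ 'm \<Rightarrow> real ^ 'm
      \<Rightarrow> (nat \<Rightarrow> real ^ 'n1 \<Rightarrow> real) \<Rightarrow> (real ^ 'n2 \<Rightarrow> ereal)
      \<Rightarrow> (nat \<Rightarrow> real ^ 'n1) \<Rightarrow> (nat \<Rightarrow> real ^ 'n2) \<Rightarrow> nat \<Rightarrow> ereal" where
  "regret1 X Z A B c f g x z T =
     (\<Sum>t = 1..T. ereal (f t (x t)) + g (z t))
     - (INF (u, v)\<in>feasible X Z A B c. \<Sum>t = 1..T. ereal (f t u) + g v)"

definition constraint_regret ::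
    "real ^ 'n1 ^ 'm \<Rightarrow> real ^ 'n2 ^ 'm \<Rightarrow> real ^ 'm
      \<Rightarrow> (nat \<Rightarrow> real ^ 'n1) \<Rightarrow> (nat \<Rightarrow> real ^ 'n2) \<Rightarrow> nat \<Rightarrow> real" where
  "constraint_regret A B c x z T =
     (\<Sum>t = 1..T. (norm (A *v x (t + 1) + B *v z (t + 1) - c))\<^sup>2
        + (norm (B *v z (t + 1) - B *v z t))\<^sup>2)"

definition eigenvalues :: "real ^ 'n ^ 'n \<Rightarrow> real set" where
  "eigenvalues M = {l. \<exists>v. v \<noteq> 0 \<and> M *v v = l *\<^sub>R v}"

definition lambda_max :: "real ^ 'n2 ^ 'm \<Rightarrow> real" where
  "lambda_max B = Max (eigenvalues (transpose B ** B))"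

end

theory Submission
  imports Defs
begin

text \<open>The optimality conditions of the two updates, evaluated at a feasible pair \<open>(u, v)\<close>, bound
  the per-step regret at time \<open>t + 1\<close> by the decrease of the Lyapunov function
  \<open>V t = (norm (y t))\<^sup>2 / (2\<rho>) + \<rho>/2 (norm (B v - B (z t)))\<^sup>2 + \<eta> B\<^sub>\<phi> u (x t)\<close>
  minus \<open>\<rho>/2 (norm (A (x (t + 1)) + B (z t) - c))\<^sup>2 + \<eta> B\<^sub>\<phi> (x (t + 1)) (x t)\<close>.
  Summed over \<open>t\<close>, the Bregman term left over pays for replacing \<open>f t (x (t + 1))\<close> by
  \<open>f t (x t)\<close> (Hoelder and Young), which gives the regret bound; the residual term dominates the
  constraint violation because two consecutive \<open>z\<close>-updates give
  \<open>(A (x (t + 1)) + B (z (t + 1)) - c) \<bullet> (B (z (t + 1)) - B (z t)) \<le> 0\<close>.\<close>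

section \<open>Hoelder's inequality for conjugate exponents\<close>

text \<open>Divide by the two norms \<open>P\<close> and \<open>Q\<close> and sum Young's
  inequality: the normalised power sums contribute 1/p + 1/q = 1. If a power sum is 0, that family
  vanishes on \<open>I\<close>.\<close>

lemma Holder_inequality_sum:
  fixes p q :: real
  assumes "p > 1" "q > 1" "1 / p + 1 / q = 1" "finite I"
  shows "(\<Sum>i\<in>I. \<bar>a i\<bar> * \<bar>b i\<bar>)
    \<le> (\<Sum>i\<in>I. \<bar>a i\<bar> powr p) powr (1 / p) * (\<Sum>i\<in>I. \<bar>b i\<bar> powr q) powr (1 / q)"
proof -
  define S where "S = (\<Sum>i\<in>I. \<bar>a i\<bar> powr p)"
  define R where "R = (\<Sum>i\<in>I. \<bar>b i\<bar> powr q)"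
  have nonneg: "S \<ge> 0" "R \<ge> 0" by (auto simp: S_def R_def sum_nonneg)
  show ?thesis
  proof (cases "S = 0 \<or> R = 0")
    case True
    then have "(\<forall>i\<in>I. a i = 0) \<or> (\<forall>i\<in>I. b i = 0)"
      using assms(4) by (auto simp: S_def R_def sum_nonneg_eq_0_iff)
    then have "(\<Sum>i\<in>I. \<bar>a i\<bar> * \<bar>b i\<bar>) = 0" by auto
    then show ?thesis by simp
  next
    case False
    with nonneg have pos: "S > 0" "R > 0" by auto
    define P where "P = S powr (1 / p)"
    define Q where "Q = R powr (1 / q)"
    have PQ: "P > 0" "Q > 0" using pos by (auto simp: P_def Q_def)
    have pw: "P powr p = S" "Q powr q = R"
      using pos assms by (auto simp: P_def Q_def powr_powr)
    have "(\<Sum>i\<in>I. \<bar>a i\<bar> / P * (\<bar>b i\<bar> / Q)) \<le> (\<Sum>i\<in>I. \<bar>a i\<bar> powr p / S / p + \<bar>b i\<bar> powr q / R / q)"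
    proof (rule sum_mono)
      fix i
      show "\<bar>a i\<bar> / P * (\<bar>b i\<bar> / Q) \<le> \<bar>a i\<bar> powr p / S / p + \<bar>b i\<bar> powr q / R / q"
        using Youngs_inequality[OF assms(1-3), of "\<bar>a i\<bar> / P" "\<bar>b i\<bar> / Q"] PQ pw
        by (simp add: powr_divide)
    qed
    also have "\<dots> = S / S / p + R / R / q"
      by (simp add: sum.distrib flip: sum_divide_distrib S_def R_def)
    also have "\<dots> = 1" using pos assms(3) by simp
    finally have "(\<Sum>i\<in>I. \<bar>a i\<bar> * \<bar>b i\<bar>) / (P * Q) \<le> 1"
      by (simp add: sum_divide_distrib)
    then show ?thesis using PQ by (simp add: P_def Q_def S_def R_def)
  qed
qed

lemma abs_le_infnorm_cart: "\<bar>x $ i\<bar> \<le> infnorm (x :: real ^ 'n)"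
  using Basis_le_infnorm[of "axis i 1" x] by (simp add: inner_axis)

lemma inner_le_pnorm_1_infnorm: "x \<bullet> y \<le> pnorm 1 x * infnorm (y :: real ^ 'n)"
proof -
  have "x \<bullet> y \<le> (\<Sum>i\<in>UNIV. \<bar>x $ i\<bar> * infnorm y)"
    unfolding inner_vec_def
  proof (rule sum_mono)
    fix i
    have "x $ i * y $ i \<le> \<bar>x $ i\<bar> * \<bar>y $ i\<bar>" by (metis abs_ge_self abs_mult)
    also have "\<dots> \<le> \<bar>x $ i\<bar> * infnorm y" by (simp add: abs_le_infnorm_cart mult_left_mono)
    finally show "x $ i \<bullet> y $ i \<le> \<bar>x $ i\<bar> * infnorm y" by simp
  qed
  then show ?thesis by (simp add: pnorm_def sum_distrib_right sum_nonneg)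
qed

text \<open>Since 1 / \<infinity> = 0 in \<open>ereal\<close>, an infinite exponent forces the other
  to be 1 and conversely; otherwise both are finite and exceed 1. The first two cases pair the sum
  norm with \<open>infnorm\<close>, the third is Young's range.\<close>

lemma conjugate_exponents_cases:
  assumes "conjugate_exponents p q"
  obtains "p = \<infinity>" "q = 1" | "p = 1" "q = \<infinity>"
  | a b where "p = ereal a" "q = ereal b" "a > 1" "b > 1" "1 / a + 1 / b = 1"
proof (cases p)
  case (real a)
  show ?thesis
  proof (cases q)
    case (real b)
    have ab: "a \<ge> 1" "b \<ge> 1" "1 / a + 1 / b = 1"
      using assms real \<open>p = ereal a\<close> 
      by (auto simp: conjugate_exponents_def one_ereal_def split: if_splits)
    have "a \<noteq> 1" "b \<noteq> 1" using ab by auto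
    with ab show ?thesis using that(3) real \<open>p = ereal a\<close> by force
  qed (use assms real that in \<open>auto simp: conjugate_exponents_def one_ereal_def split: if_splits\<close>)
next
  case PInf
  then show ?thesis using assms that 
    by (cases q) (auto simp: conjugate_exponents_def one_ereal_def split: if_splits)
qed (use assms in \<open>auto simp: conjugate_exponents_def\<close>)

lemma inner_le_pnorm_mult:
  assumes "conjugate_exponents p q"
  shows "x \<bullet> y \<le> pnorm q x * pnorm p (y :: real ^ 'n)"
  using assms
proof (cases rule: conjugate_exponents_cases)
  case 1
  then show ?thesis using inner_le_pnorm_1_infnorm[of x y] by (simp add: pnorm_def)
next
  case 2
  then show ?thesis using inner_le_pnorm_1_infnorm[of y x] by (simp add: pnorm_def inner_commute mult.commute)
next
  case (3 a b)
  have "x \<bullet> y \<le> (\<Sum>i\<in>UNIV. \<bar>x $ i\<bar> * \<bar>y $ i\<bar>)"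
    unfolding inner_vec_def by (rule sum_mono) (metis abs_ge_self abs_mult inner_real_def)
  also have "\<dots> \<le> (\<Sum>i\<in>UNIV. \<bar>x $ i\<bar> powr b) powr (1 / b) * (\<Sum>i\<in>UNIV. \<bar>y $ i\<bar> powr a) powr (1 / a)"
    using Holder_inequality_sum[of b a UNIV "($) x" "($) y"] 3 by (simp add: add.commute)
  finally show ?thesis by (simp add: pnorm_def 3)
qed

section \<open>Existence of subgradients\<close>

text \<open>A hyperplane separating (x, f x) from the convex strict epigraph \<open>S\<close> is not
  vertical, because \<open>f\<close> is finite everywhere; its slope is a subgradient. The bound on
  all subgradients then becomes usable at every \<open>x t\<close>.\<close>

lemma subdifferential_nonempty:
  fixes f :: "'a::euclidean_space \<Rightarrow> real"
  assumes f: "convex_on UNIV f"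
  shows "subdifferential f x \<noteq> {}"
proof -
  define S where "S = {(y, r). f y < r}"
  have "convex S"
  proof (rule convexI)
    fix v w :: "'a \<times> real" and s t :: real
    assume "v \<in> S" "w \<in> S" and st: "0 \<le> s" "0 \<le> t" "s + t = 1"
    then have vw: "f (fst v) < snd v" "f (fst w) < snd w" by (auto simp: S_def)
    have "f (s *\<^sub>R fst v + t *\<^sub>R fst w) \<le> s * f (fst v) + t * f (fst w)"
      using f st by (simp add: convex_on_def)
    also have "\<dots> < s * snd v + t * snd w"
    proof (cases "s = 0")
      case False
      then show ?thesis using st vw
        by (intro add_less_le_mono mult_strict_left_mono mult_left_mono) auto
    qed (use st vw in auto)
    finally show "s *\<^sub>R v + t *\<^sub>R w \<in> S"
      by (simp add: S_def split_beta)
  qed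
  moreover have "(x, f x + 1) \<in> S" "S \<inter> {(x, f x)} = {}" by (auto simp: S_def)
  ultimately have "\<exists>n b. n \<noteq> 0 \<and> (\<forall>v\<in>S. n \<bullet> v \<le> b) \<and> (\<forall>v\<in>{(x, f x)}. n \<bullet> v \<ge> b)"
    by (intro separating_hyperplane_sets) blast+
  then obtain n b where n: "n \<noteq> 0" "\<And>v. v \<in> S \<Longrightarrow> n \<bullet> v \<le> b" "n \<bullet> (x, f x) \<ge> b"
    by (metis singletonI)
  obtain a \<beta> where [simp]: "n = (a, \<beta>)" by (cases n)
  have le: "a \<bullet> y + \<beta> * r \<le> a \<bullet> x + \<beta> * f x" if "f y < r" for y r
    using n(2)[of "(y, r)"] n(3) that by (simp add: S_def)
  have "\<beta> \<le> 0" using le[of x "f x + 1"] by (simp add: algebra_simps)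
  \<comment> \<open>A vertical hyperplane, tested above the point \<open>x + a\<close>, would have
    normal 0.\<close>
  moreover have "\<beta> \<noteq> 0"
  proof
    assume "\<beta> = 0"
    then have "a \<bullet> a \<le> 0" using le[of "x + a" "f (x + a) + 1"] by (simp add: inner_add_right)
    then show False using n(1) \<open>\<beta> = 0\<close> by (simp add: zero_prod_def flip: not_less)
  qed
  ultimately have \<beta>: "\<beta> < 0" by simp
  have "f y \<ge> f x + (a /\<^sub>R (- \<beta>)) \<bullet> (y - x)" for y
  \<comment> \<open>\<open>S\<close> contains only points strictly above the graph, so the
    inequality on the graph is reached by a limit.\<close>
  proof (rule field_le_epsilon)
    fix e :: real assume "e > 0"
    then have "a \<bullet> (y - x) \<le> (- \<beta>) * (f y + e - f x)"
      using le[of y "f y + e"] by (simp add: algebra_simps)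
    then have "a \<bullet> (y - x) / (- \<beta>) \<le> f y + e - f x" using \<beta> by (simp add: field_simps)
    then show "f x + (a /\<^sub>R (- \<beta>)) \<bullet> (y - x) \<le> f y + e" by (simp add: divide_inverse mult.commute)
  qed
  then show ?thesis unfolding subdifferential_def by blast
qed

section \<open>The spectral bound for B\<close>

lemma inner_gram: "v \<bullet> ((transpose B ** B) *v w) = (B *v v) \<bullet> (B *v (w :: real ^ 'n))"
  by (metis dot_lmul_matrix matrix_vector_mul_assoc vector_transpose_matrix)

text \<open>Eigenvectors of a symmetric matrix for distinct eigenvalues are orthogonal, so choosing
  one per eigenvalue gives an injective, independent family. Finiteness lets the \<open>Max\<close>
  in \<open>lambda_max\<close> bound every eigenvalue.\<close>

lemma finite_eigenvalues_gram:
  fixes B :: "real ^ 'n ^ 'm"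
  shows "finite (eigenvalues (transpose B ** B))" (is "finite (eigenvalues ?M)")
proof -
  define e where "e l = (SOME v. v \<noteq> 0 \<and> ?M *v v = l *\<^sub>R v)" for l
  have e: "e l \<noteq> 0 \<and> ?M *v e l = l *\<^sub>R e l" if "l \<in> eigenvalues ?M" for l
    unfolding e_def by (rule someI_ex) (use that in \<open>simp add: eigenvalues_def\<close>)
  have orth: "e k \<bullet> e l = 0" if "k \<in> eigenvalues ?M" "l \<in> eigenvalues ?M" "k \<noteq> l" for k l
  proof -
    have "l * (e k \<bullet> e l) = k * (e k \<bullet> e l)"
      using inner_gram[of "e k" B "e l"] inner_gram[of "e l" B "e k"] e that
      by (simp add: inner_commute)
    with \<open>k \<noteq> l\<close> show ?thesis by simp
  qed
  have "inj_on e (eigenvalues ?M)"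
    by (rule inj_onI) (metis e inner_eq_zero_iff orth)
  moreover have "independent (e ` eigenvalues ?M)"
    by (rule pairwise_orthogonal_independent)
      (use e in \<open>auto simp: pairwise_def orthogonal_def intro!: orth\<close>)
  ultimately show ?thesis using finite_imageD independent_bound by blast
qed

text \<open>A unit vector maximising \<open>norm (B *v v)\<close> is an eigenvector: otherwise the first variation
  of the Rayleigh quotient would not vanish.\<close>

lemma norm_matrix_vector_sq_le_lambda_max:
  fixes B :: "real ^ 'n ^ 'm"
  shows "(norm (B *v v))\<^sup>2 \<le> lambda_max B * (norm v)\<^sup>2"
proof -
  let ?M = "transpose B ** B"
  have "continuous_on (sphere 0 1) (\<lambda>v. norm (B *v v))"
    by (intro continuous_intros linear_continuous_on) auto
  moreover have "sphere (0 :: real ^ 'n) 1 \<noteq> {}" by simp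
  ultimately obtain w where w: "norm w = 1" and
    max: "\<And>v. norm v = 1 \<Longrightarrow> norm (B *v v) \<le> norm (B *v w)"
    using continuous_attains_sup[of "sphere 0 1" "\<lambda>v. norm (B *v v)"] by auto
  define l where "l = (norm (B *v w))\<^sup>2"
  have bound: "(norm (B *v v))\<^sup>2 \<le> l * (norm v)\<^sup>2" for v
  proof (cases "v = 0")
    case False
    then have "norm (B *v (v /\<^sub>R norm v)) \<le> norm (B *v w)" by (intro max) simp
    then have "norm (B *v v) \<le> norm (B *v w) * norm v"
      using False by (simp add: matrix_vector_mult_scaleR field_simps)
    then show ?thesis by (metis l_def norm_ge_zero power_mono power_mult_distrib)
  qed simp
  have "?M *v w = l *\<^sub>R w"
  proof -
    \<comment> \<open>\<open>d\<close> is the defect in the eigenvalue equation. Moving from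
      \<open>w\<close> to \<open>w + s *\<^sub>R d\<close> changes
      \<open>(norm (B *v v))\<^sup>2 - l * (norm v)\<^sup>2\<close> to first order by
      \<open>2 * s * (norm d)\<^sup>2\<close>, while \<open>bound\<close> keeps it nonpositive;
      small s then forces d = 0.\<close>
    define d where "d = ?M *v w - l *\<^sub>R w"
    define C where "C = \<bar>l * (norm d)\<^sup>2 - (norm (B *v d))\<^sup>2\<bar>"
    have "2 * (norm d)\<^sup>2 \<le> s * C" if "s > 0" for s
    proof -
      have "(norm (B *v (w + s *\<^sub>R d)))\<^sup>2 = l + 2 * s * ((B *v d) \<bullet> (B *v w)) + s\<^sup>2 * (norm (B *v d))\<^sup>2"
        unfolding l_def matrix_vector_right_distrib matrix_vector_mult_scaleR power2_norm_eq_inner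
        by (simp add: inner_add_left inner_add_right inner_commute power2_eq_square)
      moreover have "(norm (w + s *\<^sub>R d))\<^sup>2 = 1 + 2 * s * (d \<bullet> w) + s\<^sup>2 * (norm d)\<^sup>2"
        using w unfolding power2_norm_eq_inner norm_eq_1
        by (simp add: inner_add_left inner_add_right inner_commute power2_eq_square)
      ultimately have "2 * s * ((B *v d) \<bullet> (B *v w) - l * (d \<bullet> w)) \<le> s\<^sup>2 * (l * (norm d)\<^sup>2 - (norm (B *v d))\<^sup>2)"
        using bound[of "w + s *\<^sub>R d"] by (simp add: algebra_simps)
      also have "\<dots> \<le> s\<^sup>2 * C" unfolding C_def by (intro mult_left_mono) auto
      also have "(B *v d) \<bullet> (B *v w) - l * (d \<bullet> w) = (norm d)\<^sup>2"
        using inner_gram[of d B w] by (simp add: d_def power2_norm_eq_inner inner_diff_right)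
      finally have "s * (2 * (norm d)\<^sup>2) \<le> s * (s * C)" by (simp add: power2_eq_square mult_ac)
      with \<open>s > 0\<close> show ?thesis by simp
    qed
    note * = this
    have "2 * (norm d)\<^sup>2 \<le> 0"
    proof (rule field_le_epsilon)
      fix e :: real assume "e > 0"
      have "C \<ge> 0" by (simp add: C_def)
      \<comment> \<open>The step length \<open>e / (C + 1)\<close> also covers C = 0.\<close>
      have "2 * (norm d)\<^sup>2 \<le> e / (C + 1) * C" using \<open>e > 0\<close> \<open>C \<ge> 0\<close> by (intro *) simp
      also have "\<dots> \<le> e" using \<open>e > 0\<close> \<open>C \<ge> 0\<close> by (simp add: field_simps)
      finally show "2 * (norm d)\<^sup>2 \<le> 0 + e" by simp
    qed
    then show ?thesis by (simp add: d_def)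
  qed
  then have "l \<in> eigenvalues ?M" using w by (auto simp: eigenvalues_def intro!: exI[of _ w])
  then have "l \<le> lambda_max B" unfolding lambda_max_def by (simp add: finite_eigenvalues_gram)
  then show ?thesis using bound[of v] by (meson mult_right_mono order_trans zero_le_power2)
qed

section \<open>First-order optimality of the two updates\<close>

text \<open>On the segment from \<open>x\<close> to \<open>u\<close>, minimality and convexity of
  \<open>F\<close> bound the difference quotient of \<open>h\<close> below by
  \<open>F x - F u\<close>; let s tend to 0. The nonsmooth part enters by its values only, which
  suits both \<open>f t\<close> and \<open>g\<close>.\<close>

lemma minimizer_variational_inequality:
  fixes h :: "'a::real_normed_vector \<Rightarrow> real"
  assumes "convex_on S F" and x: "x \<in> S" and u: "u \<in> S"
    and h: "(h has_derivative h') (at x within S)"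
    and min: "\<And>w. w \<in> S \<Longrightarrow> F x + h x \<le> F w + h w"
  shows "0 \<le> F u - F x + h' (u - x)"
proof -
  define w where "w s = x + s *\<^sub>R (u - x)" for s :: real
  have w_eq: "w s = (1 - s) *\<^sub>R x + s *\<^sub>R u" for s by (simp add: w_def algebra_simps)
  have "convex S" using assms(1) by (simp add: convex_on_def)
  have wS: "w s \<in> S" if "s \<in> {0..1}" for s
    unfolding w_eq using \<open>convex S\<close> x u that by (intro convexD) auto
  have "(w has_derivative (\<lambda>s. s *\<^sub>R (u - x))) (at 0 within {0..1})"
    unfolding w_def by (auto intro!: derivative_eq_intros)
  moreover have "(h has_derivative h') (at (w 0) within w ` {0..1})"
    using wS by (auto simp: w_def intro: has_derivative_subset[OF h])
  ultimately have "((\<lambda>s. h (w s)) has_derivative (\<lambda>s. h' (s *\<^sub>R (u - x)))) (at 0 within {0..1})"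
    by (rule has_derivative_in_compose)
  moreover have "h' (s *\<^sub>R (u - x)) = h' (u - x) * s" for s
    using linear_scale[OF has_derivative_linear[OF h], of s "u - x"] by simp
  ultimately have "((\<lambda>s. h (w s)) has_field_derivative h' (u - x)) (at 0 within {0..1})"
    by (simp add: has_field_derivative_def)
  then have "((\<lambda>s. (h (w s) - h x) / s) \<longlongrightarrow> h' (u - x)) (at 0 within {0..1})"
    by (simp add: has_field_derivative_iff w_def)
  moreover have "\<forall>\<^sub>F s in at 0 within {0..1}. F x - F u \<le> (h (w s) - h x) / s"
    unfolding eventually_at_filter
  proof (intro always_eventually allI impI)
    fix s :: real assume s: "s \<noteq> 0" "s \<in> {0..1}"
    have "F (w s) \<le> (1 - s) * F x + s * F u"
      unfolding w_eq using assms(1) x u s by (intro convex_onD) auto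
    then have "s * (F x - F u) \<le> h (w s) - h x"
      using min[OF wS[OF s(2)]] by (simp add: algebra_simps)
    then show "F x - F u \<le> (h (w s) - h x) / s" using s by (simp add: field_simps)
  qed
  moreover have "at (0::real) within {0..1} \<noteq> bot"
    by (simp add: at_within_Icc_at_right)
  ultimately have "F x - F u \<le> h' (u - x)" by (rule tendsto_lowerbound)
  then show ?thesis by simp
qed

text \<open>\<open>M\<close> is the matrix of the block being updated; \<open>b\<close> collects the
  other block and \<open>c\<close>.\<close>

lemma has_derivative_augmented_term:
  fixes M :: "real ^ 'n ^ 'm"
  shows "((\<lambda>u. y \<bullet> (M *v u + b) + \<rho> / 2 * (norm (M *v u + b))\<^sup>2) has_derivative
    (\<lambda>d. (y + \<rho> *\<^sub>R (M *v x + b)) \<bullet> (M *v d))) (at x within S)"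
proof -
  have M: "((*v) M has_derivative (*v) M) (at x within S)"
    by (simp add: bounded_linear_imp_has_derivative)
  show ?thesis
    unfolding power2_norm_eq_inner
    by (rule derivative_eq_intros M refl)+ (simp add: algebra_simps inner_commute)
qed


lemma pnorm_nonneg: "pnorm p x \<ge> 0"
  by (simp add: pnorm_def infnorm_pos_le)

lemma pnorm_minus: "pnorm p (- x) = pnorm p x"
  by (simp add: pnorm_def infnorm_neg)

lemma lambda_max_nonneg: "lambda_max (B :: real ^ 'n ^ 'm) \<ge> 0"
proof -
  obtain v :: "real ^ 'n" where "norm v = 1" using vector_choose_size[of 1] by auto
  then show ?thesis using norm_matrix_vector_sq_le_lambda_max[of B v]
    by (metis mult.right_neutral order_trans power_one zero_le_power2)
qed

text \<open>Turns the gradient difference in the optimality condition of the x-update into Bregman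
  terms that telescope.\<close>

lemma bregman_three_point:
  "(\<phi>' a - \<phi>' b) \<bullet> (u - a) = bregman \<phi> \<phi>' u b - bregman \<phi> \<phi>' u a - bregman \<phi> \<phi>' a b"
  by (simp add: bregman_def algebra_simps)

lemma x_update_inequality:
  fixes A :: "real ^ 'n ^ 'm"
  assumes "convex X" and F: "convex_on UNIV F" and "X \<subseteq> \<Omega>"
    and \<phi>: "(\<phi> has_derivative (\<lambda>h. \<phi>' x' \<bullet> h)) (at x' within \<Omega>)"
    and min: "is_arg_min (\<lambda>u. F u + y \<bullet> residual A B c u z
             + \<rho> / 2 * (norm (residual A B c u z))\<^sup>2 + \<eta> * bregman \<phi> \<phi>' u x) (\<lambda>u. u \<in> X) x'"
    and "u \<in> X"
  shows "F x' - F u \<le> (y + \<rho> *\<^sub>R residual A B c x' z) \<bullet> (A *v (u - x'))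
    + \<eta> * (bregman \<phi> \<phi>' u x - bregman \<phi> \<phi>' u x' - bregman \<phi> \<phi>' x' x)"
proof -
  define b where "b = B *v z - c"
  have res: "residual A B c w z = A *v w + b" for w by (simp add: residual_def b_def)
  define h where "h w = y \<bullet> (A *v w + b) + \<rho> / 2 * (norm (A *v w + b))\<^sup>2 + \<eta> * bregman \<phi> \<phi>' w x" for w
  have "((\<lambda>w. bregman \<phi> \<phi>' w x) has_derivative (\<lambda>d. \<phi>' x' \<bullet> d - \<phi>' x \<bullet> d)) (at x' within X)"
    unfolding bregman_def
    by (rule derivative_eq_intros has_derivative_subset[OF \<phi> \<open>X \<subseteq> \<Omega>\<close>] refl)+ simp
  then have h: "(h has_derivative (\<lambda>d. (y + \<rho> *\<^sub>R (A *v x' + b)) \<bullet> (A *v d)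
      + \<eta> * (\<phi>' x' \<bullet> d - \<phi>' x \<bullet> d))) (at x' within X)"
    unfolding h_def by (intro has_derivative_add has_derivative_augmented_term has_derivative_mult_right)
  have "x' \<in> X" "F x' + h x' \<le> F w + h w" if "w \<in> X" for w
    using min that by (auto simp: is_arg_min_linorder res h_def add.assoc)
  then have "0 \<le> F u - F x' + ((y + \<rho> *\<^sub>R (A *v x' + b)) \<bullet> (A *v (u - x'))
      + \<eta> * (\<phi>' x' \<bullet> (u - x') - \<phi>' x \<bullet> (u - x')))"
    using minimizer_variational_inequality[OF convex_on_subset[OF F subset_UNIV \<open>convex X\<close>] _ \<open>u \<in> X\<close> h]
      \<open>u \<in> X\<close> by blast
  then show ?thesis
    by (simp add: res inner_diff_left flip: bregman_three_point)
qed

text \<open>Translates convexity of the epigraph into the real-valued form that the variational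
  inequality takes.\<close>

lemma convex_on_real_of_ereal:
  fixes g :: "'a::real_normed_vector \<Rightarrow> ereal"
  assumes "convex Z" and g: "closed_proper_convex g"
  shows "convex_on {v \<in> Z. g v \<noteq> \<infinity>} (\<lambda>v. real_of_ereal (g v))"
proof -
  have *: "u *\<^sub>R v + s *\<^sub>R w \<in> Z \<and> g (u *\<^sub>R v + s *\<^sub>R w)
      \<le> ereal (u * real_of_ereal (g v) + s * real_of_ereal (g w))"
    if vw: "v \<in> Z" "w \<in> Z" "g v \<noteq> \<infinity>" "g w \<noteq> \<infinity>" and us: "u \<ge> 0" "s \<ge> 0" "u + s = 1" for v w u s
  proof
    show "u *\<^sub>R v + s *\<^sub>R w \<in> Z" using \<open>convex Z\<close> vw us by (intro convexD)
    have "(v, real_of_ereal (g v)) \<in> ereal_epigraph g" "(w, real_of_ereal (g w)) \<in> ereal_epigraph g"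
      using vw g by (auto simp: ereal_epigraph_def closed_proper_convex_def ereal_real)
    then have "u *\<^sub>R (v, real_of_ereal (g v)) + s *\<^sub>R (w, real_of_ereal (g w)) \<in> ereal_epigraph g"
      using g us unfolding closed_proper_convex_def by (intro convexD) auto
    then show "g (u *\<^sub>R v + s *\<^sub>R w) \<le> ereal (u * real_of_ereal (g v) + s * real_of_ereal (g w))"
      by (simp add: ereal_epigraph_def)
  qed
  have finite: "g v \<noteq> - \<infinity>" for v using g by (simp add: closed_proper_convex_def)
  show ?thesis
    unfolding convex_on_def convex_def
  proof (intro conjI ballI allI impI)
    fix v w and u s :: real
    assume a: "v \<in> {v \<in> Z. g v \<noteq> \<infinity>}" "w \<in> {v \<in> Z. g v \<noteq> \<infinity>}" "0 \<le> u" "0 \<le> s" "u + s = 1"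
    then show "u *\<^sub>R v + s *\<^sub>R w \<in> {v \<in> Z. g v \<noteq> \<infinity>}"
      using *[of v w u s] by auto
    show "real_of_ereal (g (u *\<^sub>R v + s *\<^sub>R w)) \<le> u * real_of_ereal (g v) + s * real_of_ereal (g w)"
      using *[of v w u s] a finite[of "u *\<^sub>R v + s *\<^sub>R w"]
      by (cases "g (u *\<^sub>R v + s *\<^sub>R w)") auto
  qed
qed

lemma z_update_finite:
  assumes "is_arg_min (\<lambda>v. g v + ereal (k v)) (\<lambda>v. v \<in> Z) z'" and "v \<in> Z" "g v \<noteq> \<infinity>"
  shows "g z' \<noteq> (\<infinity> :: ereal)"
  using assms by (auto simp: is_arg_min_linorder)

lemma z_update_inequality:
  fixes B :: "real ^ 'n ^ 'm"
  assumes "convex Z" and g: "closed_proper_convex g"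
    and min: "is_arg_min (\<lambda>v. g v + ereal (y \<bullet> residual A B c x v
             + \<rho> / 2 * (norm (residual A B c x v))\<^sup>2)) (\<lambda>v. v \<in> Z) z'"
    and v: "v \<in> Z" "g v \<noteq> \<infinity>"
  shows "real_of_ereal (g z') - real_of_ereal (g v)
    \<le> (y + \<rho> *\<^sub>R residual A B c x z') \<bullet> (B *v (v - z'))"
proof -
  define b where "b = A *v x - c"
  have res: "residual A B c x w = B *v w + b" for w by (simp add: residual_def b_def)
  define h where "h w = y \<bullet> (B *v w + b) + \<rho> / 2 * (norm (B *v w + b))\<^sup>2" for w
  have h: "(h has_derivative (\<lambda>d. (y + \<rho> *\<^sub>R (B *v z' + b)) \<bullet> (B *v d))) (at z' within S)" for S
    unfolding h_def by (rule has_derivative_augmented_term)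
  \<comment> \<open>The minimiser has finite value, so minimality can be restated with real values
    on this set.\<close>
  let ?S = "{v \<in> Z. g v \<noteq> \<infinity>}"
  have "z' \<in> ?S" using z_update_finite[OF min v] min by (simp add: is_arg_min_def)
  have "real_of_ereal (g z') + h z' \<le> real_of_ereal (g w) + h w" if "w \<in> ?S" for w
  proof -
    have "g z' + ereal (h z') \<le> g w + ereal (h w)"
      using min that by (auto simp: is_arg_min_linorder res h_def)
    then show ?thesis using that \<open>z' \<in> ?S\<close> g
      by (cases "g z'"; cases "g w") (auto simp: closed_proper_convex_def)
  qed
  then have "0 \<le> real_of_ereal (g v) - real_of_ereal (g z') + (y + \<rho> *\<^sub>R (B *v z' + b)) \<bullet> (B *v (v - z'))"
    using \<open>z' \<in> ?S\<close> v
    by (intro minimizer_variational_inequality[OF convex_on_real_of_ereal[OF \<open>convex Z\<close> g] _ _ h]) auto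
  then show ?thesis by (simp add: res)
qed

text \<open>Here \<open>a\<close> stands for A x(t+1) - c, \<open>b\<close> and \<open>b'\<close>
  for B z(t) and B z(t+1), and \<beta> for B v. The left side is the sum of the linear terms of both
  optimality conditions at a feasible pair; expanding the square of \<open>y'\<close> gives the dual
  difference.\<close>

lemma oadm_step_identity:
  fixes y :: "'a::real_inner"
  assumes "\<rho> \<noteq> 0" and y': "y' = y + \<rho> *\<^sub>R (a + b')"
  shows "(y + \<rho> *\<^sub>R (a + b)) \<bullet> (- (a + \<beta>)) + y' \<bullet> (\<beta> - b')
    = ((norm y)\<^sup>2 - (norm y')\<^sup>2) / (2 * \<rho>) - \<rho> / 2 * (norm (a + b))\<^sup>2
      + \<rho> / 2 * ((norm (\<beta> - b))\<^sup>2 - (norm (\<beta> - b'))\<^sup>2)"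
proof -
  have "(norm y)\<^sup>2 - (norm y')\<^sup>2 = 2 * \<rho> * (- (y \<bullet> (a + b')) - \<rho> / 2 * ((a + b') \<bullet> (a + b')))"
    unfolding y' power2_norm_eq_inner
    by (simp add: inner_commute algebra_simps)
  then have "((norm y)\<^sup>2 - (norm y')\<^sup>2) / (2 * \<rho>) = - (y \<bullet> (a + b')) - \<rho> / 2 * ((a + b') \<bullet> (a + b'))"
    using \<open>\<rho> \<noteq> 0\<close> by simp
  then show ?thesis
    unfolding y' power2_norm_eq_inner
    by (simp add: inner_commute algebra_simps)
qed

section \<open>The regret and constraint bounds\<close>

theorem theorem4:
  fixes X \<Omega> :: "(real ^ 'n1) set"
    and Z :: "(real ^ 'n2) set"
    and A :: "real ^ 'n1 ^ 'm"
    and B :: "real ^ 'n2 ^ 'm"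
    and c :: "real ^ 'm"
    and f :: "nat \<Rightarrow> real ^ 'n1 \<Rightarrow> real"
    and g :: "real ^ 'n2 \<Rightarrow> ereal"
    and \<phi> :: "real ^ 'n1 \<Rightarrow> real"
    and \<phi>' :: "real ^ 'n1 \<Rightarrow> real ^ 'n1"
    and x :: "nat \<Rightarrow> real ^ 'n1"
    and z :: "nat \<Rightarrow> real ^ 'n2"
    and y :: "nat \<Rightarrow> real ^ 'm"
    and p q :: ereal
    and \<rho> \<eta> \<alpha> G\<^sub>f D\<^sub>x D\<^sub>z F :: real
    and T :: nat
  assumes "convex X" and "convex Z"
    and "\<And>t. t \<ge> 1 \<Longrightarrow> convex_on UNIV (f t)"
    and "closed_proper_convex g"
    and "feasible X Z A B c \<noteq> {}"
    and "X \<subseteq> \<Omega>" and "bregman_generator \<Omega> \<phi> \<phi>'"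
    and "G\<^sub>f > 0" and "D\<^sub>x > 0" and "D\<^sub>z > 0" and "F > 0" and "\<alpha> > 0"
    and "conjugate_exponents p q"
    and "\<And>t u s. t \<ge> 1 \<Longrightarrow> u \<in> X \<Longrightarrow> s \<in> subdifferential (f t) u \<Longrightarrow> pnorm q s \<le> G\<^sub>f"
    and "\<And>u v. u \<in> \<Omega> \<Longrightarrow> v \<in> rel_interior \<Omega> \<Longrightarrow>
           bregman \<phi> \<phi>' u v \<ge> \<alpha> / 2 * (pnorm p (u - v))\<^sup>2"
    and "x 1 = 0" and "0 \<in> X" and "y 1 = 0" and "z 1 = 0" and "0 \<in> Z"
    and "\<And>u v. (u, v) \<in> feasible X Z A B c \<Longrightarrow>
           bregman \<phi> \<phi>' u (x 1) \<le> D\<^sub>x\<^sup>2 \<and> norm (v - z 1) \<le> D\<^sub>z"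
    and "g (z 1) = 0" and "\<And>v. g v \<ge> 0"
    and "\<And>t u v. t \<ge> 1 \<Longrightarrow> (u, v) \<in> feasible X Z A B c \<Longrightarrow>
           ereal (f t (x (t + 1))) + g (z (t + 1)) - (ereal (f t u) + g v) \<ge> - ereal F"
    and "T \<ge> 1"
    and "\<eta> = G\<^sub>f * sqrt (real T) / (D\<^sub>x * sqrt (2 * \<alpha>))"
    and "\<rho> = sqrt (real T)"
    and "OADM X Z A B c f g \<Omega> \<phi> \<phi>' \<rho> \<eta> x z y"
  shows "regret1 X Z A B c f g x z T
           \<le> ereal (lambda_max B * D\<^sub>z\<^sup>2 * sqrt (real T) / 2
               + sqrt 2 * G\<^sub>f * D\<^sub>x * sqrt (real T) / sqrt \<alpha>)
       \<and> constraint_regret A B c x z T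
           \<le> lambda_max B * D\<^sub>z\<^sup>2 + 2 * sqrt 2 * D\<^sub>x * G\<^sub>f / sqrt \<alpha> + 2 * F * sqrt (real T)"
proof -
  let ?Br = "bregman \<phi> \<phi>'"
  define G where "G v = real_of_ereal (g v)" for v
  \<comment> \<open>\<open>C\<close> will bound the Lyapunov function at time 1.\<close>
  define C where "C = \<eta> * D\<^sub>x\<^sup>2 + \<rho> / 2 * (lambda_max B * D\<^sub>z\<^sup>2)"
  have T: "real T > 0" using \<open>T \<ge> 1\<close> by simp
  have pos: "\<rho> > 0" "\<eta> > 0"
    using T \<open>\<rho> = _\<close> \<open>\<eta> = _\<close> \<open>G\<^sub>f > 0\<close> \<open>D\<^sub>x > 0\<close> \<open>\<alpha> > 0\<close> by auto
  have gninf: "g v \<noteq> - \<infinity>" for v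
    using \<open>closed_proper_convex g\<close> by (simp add: closed_proper_convex_def)
  have G: "g v = ereal (G v)" if "g v \<noteq> \<infinity>" for v
    using gninf[of v] that by (cases "g v") (auto simp: G_def)
  have G0: "G 0 = 0" "g 0 \<noteq> \<infinity>" using \<open>g (z 1) = 0\<close> \<open>z 1 = 0\<close> by (auto simp: G_def)
  have Gnn: "G v \<ge> 0" for v using \<open>\<And>v. g v \<ge> 0\<close> by (simp add: G_def real_of_ereal_pos)
  have xrel: "x t \<in> rel_interior \<Omega>"
    and xmin: "is_arg_min
          (\<lambda>u. f t u + y t \<bullet> residual A B c u (z t)
             + \<rho> / 2 * (norm (residual A B c u (z t)))\<^sup>2 + \<eta> * ?Br u (x t))
          (\<lambda>u. u \<in> X) (x (t + 1))"
    and zmin: "is_arg_min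
          (\<lambda>v. g v + ereal (y t \<bullet> residual A B c (x (t + 1)) v
             + \<rho> / 2 * (norm (residual A B c (x (t + 1)) v))\<^sup>2))
          (\<lambda>v. v \<in> Z) (z (t + 1))"
    and yupd: "y (t + 1) = y t + \<rho> *\<^sub>R residual A B c (x (t + 1)) (z (t + 1))"
    if "t \<ge> 1" for t
    using \<open>OADM X Z A B c f g \<Omega> \<phi> \<phi>' \<rho> \<eta> x z y\<close> that unfolding OADM_def by simp_all
  \<comment> \<open>Time 1 is covered by the initial values, later times by the updates; the
    competitor 0, with \<open>g 0 = 0\<close>, keeps \<open>g (z t)\<close> finite.\<close>
  have xX: "x t \<in> X" and zZ: "z t \<in> Z" and zfin: "g (z t) \<noteq> \<infinity>" if "t \<ge> 1" for t
  proof -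
    have "x t \<in> X \<and> z t \<in> Z \<and> g (z t) \<noteq> \<infinity>"
    proof (cases "t = 1")
      case True
      then show ?thesis
        using \<open>x 1 = 0\<close> \<open>0 \<in> X\<close> \<open>z 1 = 0\<close> \<open>0 \<in> Z\<close> G0 by simp
    next
      case False
      define s where "s = t - 1"
      have s: "s \<ge> 1" "t = s + 1" using that False by (auto simp: s_def)
      have "g (z (s + 1)) \<noteq> \<infinity>"
        using z_update_finite[OF zmin[OF s(1)] \<open>0 \<in> Z\<close> G0(2)] .
      then show ?thesis
        using xmin[OF s(1)] zmin[OF s(1)] unfolding s(2) is_arg_min_def by blast
    qed
    then show "x t \<in> X" "z t \<in> Z" "g (z t) \<noteq> \<infinity>" by auto
  qed
  have \<phi>: "(\<phi> has_derivative (\<lambda>h. \<phi>' v \<bullet> h)) (at v within \<Omega>)" if "v \<in> rel_interior \<Omega>" for v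
    using \<open>bregman_generator \<Omega> \<phi> \<phi>'\<close> that by (simp add: bregman_generator_def)
  have Brnn: "?Br u (x t) \<ge> 0" if "u \<in> X" "t \<ge> 1" for u t
  proof -
    have "0 \<le> \<alpha> / 2 * (pnorm p (u - x t))\<^sup>2" using \<open>\<alpha> > 0\<close> by simp
    also have "\<dots> \<le> ?Br u (x t)" using assms(15) \<open>X \<subseteq> \<Omega>\<close> xrel that by blast
    finally show ?thesis .
  qed
  \<comment> \<open>The multiplier in the z-condition is exactly the new dual iterate
    \<open>y (t + 1)\<close>.\<close>
  have zopt: "G (z (t + 1)) - G v \<le> y (t + 1) \<bullet> (B *v (v - z (t + 1)))"
    if "t \<ge> 1" "v \<in> Z" "g v \<noteq> \<infinity>" for t v
    using z_update_inequality[OF \<open>convex Z\<close> \<open>closed_proper_convex g\<close> zmin that(2,3), OF that(1)] yupd[OF that(1)]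
    by (simp add: G_def)
  \<comment> \<open>The residual with new x and old z, as it occurs in the x-update.\<close>
  define r where "r t = A *v x (t + 1) + B *v z t - c" for t
  define V where "V u v t = (norm (y t))\<^sup>2 / (2 * \<rho>) + \<rho> / 2 * (norm (B *v v - B *v z t))\<^sup>2
    + \<eta> * ?Br u (x t)" for u v t

  have feasD: "u \<in> X" "v \<in> Z" "A *v u = c - B *v v" "g v \<noteq> \<infinity>"
    "?Br u (x 1) \<le> D\<^sub>x\<^sup>2" "norm (v - z 1) \<le> D\<^sub>z" if "(u, v) \<in> feasible X Z A B c" for u v
  proof -
    show "u \<in> X" "v \<in> Z" using that by (auto simp: feasible_def)
    have "A *v u + B *v v = c" using that by (auto simp: feasible_def)
    then show "A *v u = c - B *v v" by (simp add: eq_diff_eq)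
    show "g v \<noteq> \<infinity>"
    proof
      \<comment> \<open>As \<open>g (z 2)\<close> is finite, the difference bounded below by
        \<open>- F\<close> would be minus infinity.\<close>
      assume "g v = \<infinity>"
      then show False using assms(24)[OF _ that, of 1] G[OF zfin[of 2]] by (simp add: numeral_2_eq_2)
    qed
    show "?Br u (x 1) \<le> D\<^sub>x\<^sup>2" "norm (v - z 1) \<le> D\<^sub>z" using assms(21)[OF that] by auto
  qed

  have step: "f t (x (t + 1)) + G (z (t + 1)) - (f t u + G v)
      \<le> V u v t - V u v (t + 1) - \<rho> / 2 * (norm (r t))\<^sup>2 - \<eta> * ?Br (x (t + 1)) (x t)"
    if t: "t \<ge> 1" and uv: "(u, v) \<in> feasible X Z A B c" for t u v
  proof -
    define a where "a = A *v x (t + 1) - c"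
    let ?\<beta> = "B *v v"
    have res: "residual A B c (x (t + 1)) w = a + B *v w" for w by (simp add: a_def residual_def)
    have "A *v (u - x (t + 1)) = - (a + ?\<beta>)"
      using feasD(3)[OF uv] by (simp add: a_def matrix_vector_mult_diff_distrib)
    then have "f t (x (t + 1)) - f t u \<le> (y t + \<rho> *\<^sub>R (a + B *v z t)) \<bullet> (- (a + ?\<beta>))
        + \<eta> * (?Br u (x t) - ?Br u (x (t + 1)) - ?Br (x (t + 1)) (x t))"
      \<comment> \<open>The derivative of \<phi> is taken at the new iterate, so \<open>xrel\<close>
        is used at time t + 1.\<close>
      using x_update_inequality[OF \<open>convex X\<close> assms(3)[OF t] \<open>X \<subseteq> \<Omega>\<close> \<phi>[OF xrel] xmin[OF t] feasD(1)[OF uv]]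
      unfolding res by simp
    moreover have "\<eta> * (?Br u (x t) - ?Br u (x (t + 1)) - ?Br (x (t + 1)) (x t))
        = \<eta> * ?Br u (x t) - \<eta> * ?Br u (x (t + 1)) - \<eta> * ?Br (x (t + 1)) (x t)"
      by (simp add: right_diff_distrib)
    moreover have "G (z (t + 1)) - G v \<le> y (t + 1) \<bullet> (?\<beta> - B *v z (t + 1))"
      using zopt[OF t feasD(2,4)[OF uv]] by (simp add: matrix_vector_mult_diff_distrib)
    moreover have "(y t + \<rho> *\<^sub>R (a + B *v z t)) \<bullet> (- (a + ?\<beta>)) + y (t + 1) \<bullet> (?\<beta> - B *v z (t + 1))
      = ((norm (y t))\<^sup>2 - (norm (y (t + 1)))\<^sup>2) / (2 * \<rho>) - \<rho> / 2 * (norm (a + B *v z t))\<^sup>2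
        + \<rho> / 2 * ((norm (?\<beta> - B *v z t))\<^sup>2 - (norm (?\<beta> - B *v z (t + 1)))\<^sup>2)"
      using pos yupd[OF t] unfolding res by (intro oadm_step_identity) auto
    moreover have "V u v t - V u v (t + 1) = ((norm (y t))\<^sup>2 - (norm (y (t + 1)))\<^sup>2) / (2 * \<rho>)
        + \<rho> / 2 * ((norm (?\<beta> - B *v z t))\<^sup>2 - (norm (?\<beta> - B *v z (t + 1)))\<^sup>2)
        + (\<eta> * ?Br u (x t) - \<eta> * ?Br u (x (t + 1)))"
      by (simp add: V_def diff_divide_distrib right_diff_distrib)
    moreover have "r t = a + B *v z t" by (simp add: r_def a_def)
    ultimately show ?thesis by simp
  qed

  have V_telescope: "(\<Sum>t = 1..T. V u v t - V u v (t + 1)) \<le> C"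
    if uv: "(u, v) \<in> feasible X Z A B c" for u v
  proof -
    have "(\<Sum>t = 1..T. V u v (t + 1) - V u v t) = V u v (T + 1) - V u v 1"
      using sum_Suc_diff[of 1 T "V u v"] by simp
    then have "(\<Sum>t = 1..T. V u v t - V u v (t + 1)) = V u v 1 - V u v (T + 1)"
      by (simp add: sum_subtractf)
    also have "\<dots> \<le> V u v 1"
    proof -
      have "V u v (T + 1) \<ge> 0"
        unfolding V_def using pos Brnn[OF feasD(1)[OF uv], of "T + 1"]
        by (intro add_nonneg_nonneg mult_nonneg_nonneg divide_nonneg_nonneg) auto
      then show ?thesis by simp
    qed
    \<comment> \<open>At time 1 the dual term vanishes and the penalty is
      \<open>\<rho> / 2 * (norm (B *v v))\<^sup>2\<close>.\<close>
    also have "\<dots> \<le> C"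
    proof -
      have "(norm (B *v v))\<^sup>2 \<le> lambda_max B * (norm v)\<^sup>2"
        by (rule norm_matrix_vector_sq_le_lambda_max)
      also have "\<dots> \<le> lambda_max B * D\<^sub>z\<^sup>2"
        using feasD(6)[OF uv] \<open>z 1 = 0\<close> by (intro mult_left_mono power_mono lambda_max_nonneg) auto
      finally have "\<rho> / 2 * (norm (B *v v))\<^sup>2 \<le> \<rho> / 2 * (lambda_max B * D\<^sub>z\<^sup>2)"
        using pos by (intro mult_left_mono) auto
      moreover have "\<eta> * ?Br u (x 1) \<le> \<eta> * D\<^sub>x\<^sup>2"
        using pos feasD(5)[OF uv] by (intro mult_left_mono) auto
      ultimately show ?thesis using \<open>y 1 = 0\<close> \<open>z 1 = 0\<close> by (simp add: V_def C_def)
    qed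
    finally show ?thesis .
  qed

  have grad: "f t (x t) - f t (x (t + 1)) \<le> \<eta> * ?Br (x (t + 1)) (x t) + G\<^sub>f\<^sup>2 / (2 * \<alpha> * \<eta>)"
    if t: "t \<ge> 1" for t
  proof -
    define d where "d = pnorm p (x (t + 1) - x t)"
    obtain s where s: "s \<in> subdifferential (f t) (x t)"
      using subdifferential_nonempty[OF assms(3)[OF t]] by blast
    have "f t (x t) - f t (x (t + 1)) \<le> (- s) \<bullet> (x (t + 1) - x t)"
      using s by (auto simp: subdifferential_def algebra_simps dest: spec[of _ "x (t + 1)"])
    also have "\<dots> \<le> pnorm q (- s) * d"
      unfolding d_def by (rule inner_le_pnorm_mult[OF \<open>conjugate_exponents p q\<close>])
    also have "\<dots> \<le> G\<^sub>f * d"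
      using assms(14)[OF t xX[OF t] s] by (simp add: d_def pnorm_minus pnorm_nonneg mult_right_mono)
    also have "\<dots> \<le> \<eta> * (\<alpha> / 2 * d\<^sup>2) + G\<^sub>f\<^sup>2 / (2 * \<alpha> * \<eta>)"
    proof -
      \<comment> \<open>Young's inequality as a completed square, weighted so that the term in
        \<open>d\<^sup>2\<close> is what strong convexity of \<phi> controls.\<close>
      have "0 \<le> (G\<^sub>f - \<alpha> * \<eta> * d)\<^sup>2 / (2 * \<alpha> * \<eta>)" using pos \<open>\<alpha> > 0\<close> by simp
      also have "\<dots> = \<eta> * (\<alpha> / 2 * d\<^sup>2) + G\<^sub>f\<^sup>2 / (2 * \<alpha> * \<eta>) - G\<^sub>f * d"
        using pos \<open>\<alpha> > 0\<close> by (simp add: field_simps power2_eq_square)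
      finally show ?thesis by simp
    qed
    also have "\<dots> \<le> \<eta> * ?Br (x (t + 1)) (x t) + G\<^sub>f\<^sup>2 / (2 * \<alpha> * \<eta>)"
      unfolding d_def using \<open>X \<subseteq> \<Omega>\<close> xX[of "t + 1"] xrel[OF t] pos
      by (intro add_right_mono mult_left_mono assms(15)) auto
    finally show ?thesis .
  qed

  have \<eta>D: "\<eta> * D\<^sub>x\<^sup>2 = sqrt 2 * G\<^sub>f * D\<^sub>x * sqrt (real T) / sqrt \<alpha> / 2"
  proof -
    have "\<eta> * D\<^sub>x\<^sup>2 = G\<^sub>f * D\<^sub>x * sqrt (real T) / (sqrt 2 * sqrt \<alpha>)"
      using \<open>D\<^sub>x > 0\<close> by (simp add: \<open>\<eta> = _\<close> real_sqrt_mult power2_eq_square)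
    also have "\<dots> = G\<^sub>f * D\<^sub>x * sqrt (real T) / sqrt \<alpha> * (1 / sqrt 2)" by simp
    also have "1 / sqrt 2 = sqrt 2 / (2 :: real)" by (simp add: field_simps)
    finally show ?thesis by (simp add: mult_ac)
  qed
  \<comment> \<open>The choice of \<eta> balances the two errors: the T gradient terms together
    equal the initial Bregman budget, each being half of the second term in the regret
    bound.\<close>
  have G\<eta>: "real T * (G\<^sub>f\<^sup>2 / (2 * \<alpha> * \<eta>)) = \<eta> * D\<^sub>x\<^sup>2"
  proof -
    have "\<eta>\<^sup>2 * D\<^sub>x\<^sup>2 * (2 * \<alpha>) = real T * G\<^sub>f\<^sup>2"
      using \<open>D\<^sub>x > 0\<close> \<open>\<alpha> > 0\<close> by (simp add: \<open>\<eta> = _\<close> power_divide power_mult_distrib)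
    then show ?thesis using pos \<open>\<alpha> > 0\<close> by (simp add: field_simps power2_eq_square)
  qed

  \<comment> \<open>The bound on the regret\<close>
  have "regret1 X Z A B c f g x z T
      \<le> ereal (lambda_max B * D\<^sub>z\<^sup>2 * sqrt (real T) / 2
               + sqrt 2 * G\<^sub>f * D\<^sub>x * sqrt (real T) / sqrt \<alpha>)" (is "_ \<le> ereal ?bound")
  proof -
    define L where "L = (\<Sum>t = 1..T. f t (x t) + G (z t))"
    have L: "(\<Sum>t = 1..T. ereal (f t (x t)) + g (z t)) = ereal L"
      unfolding L_def sum_ereal[symmetric] by (intro sum.cong) (auto simp: G[OF zfin])
    \<comment> \<open>The regret evaluates \<open>g\<close> at \<open>z t\<close>, the step
      inequality at \<open>z (t + 1)\<close>; the shift costs nothing as \<open>g\<close> is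
      nonnegative and vanishes at \<open>z 1\<close>.\<close>
    have shift: "(\<Sum>t = 1..T. G (z t)) \<le> (\<Sum>t = 1..T. G (z (t + 1)))"
    proof -
      have "(\<Sum>t = 1..T. G (z (t + 1)) - G (z t)) = G (z (T + 1)) - G (z 1)"
        using sum_Suc_diff[of 1 T "\<lambda>t. G (z t)"] by simp
      then show ?thesis using Gnn[of "z (T + 1)"] G0 \<open>z 1 = 0\<close> by (simp add: sum_subtractf)
    qed
    have "ereal (L - ?bound) \<le> (\<Sum>t = 1..T. ereal (f t u) + g v)"
      if uv: "(u, v) \<in> feasible X Z A B c" for u v
    proof -
      have "L - (\<Sum>t = 1..T. f t u + G v) \<le> (\<Sum>t = 1..T. f t (x t) + G (z (t + 1)) - (f t u + G v))"
        using shift by (simp add: L_def sum.distrib sum_subtractf)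
      also have "\<dots> \<le> (\<Sum>t = 1..T. V u v t - V u v (t + 1) + G\<^sub>f\<^sup>2 / (2 * \<alpha> * \<eta>))"
      proof (rule sum_mono)
        fix t assume "t \<in> {1..T}"
        then have t: "t \<ge> 1" by simp
        \<comment> \<open>The residual term is dropped, and the Bregman term of \<open>grad\<close>
          cancels against that of \<open>step\<close>.\<close>
        have "0 \<le> \<rho> / 2 * (norm (r t))\<^sup>2" using pos by simp
        then show "f t (x t) + G (z (t + 1)) - (f t u + G v)
            \<le> V u v t - V u v (t + 1) + G\<^sub>f\<^sup>2 / (2 * \<alpha> * \<eta>)"
          using grad[OF t] step[OF t uv] by linarith
      qed
      also have "\<dots> \<le> C + \<eta> * D\<^sub>x\<^sup>2"
        using V_telescope[OF uv] G\<eta> by (simp add: sum.distrib)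
      also have "\<dots> = ?bound" unfolding C_def \<eta>D \<open>\<rho> = _\<close> by (simp add: mult_ac)
      finally have "L - ?bound \<le> (\<Sum>t = 1..T. f t u + G v)" by simp
      then show ?thesis by (simp add: G[OF feasD(4)[OF uv]])
    qed
    then have "ereal (L - ?bound) \<le> (INF (u, v)\<in>feasible X Z A B c. \<Sum>t = 1..T. ereal (f t u) + g v)"
      by (intro INF_greatest) auto
    then have "regret1 X Z A B c f g x z T \<le> ereal L - ereal (L - ?bound)"
      unfolding regret1_def L by (intro ereal_minus_mono) auto
    then show ?thesis by simp
  qed

  \<comment> \<open>The bound on the constraint violation\<close>
  moreover have "constraint_regret A B c x z T
      \<le> lambda_max B * D\<^sub>z\<^sup>2 + 2 * sqrt 2 * D\<^sub>x * G\<^sub>f / sqrt \<alpha> + 2 * F * sqrt (real T)"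
  proof -
    \<comment> \<open>The claim mentions no comparator, so one arbitrary feasible pair is
      fixed.\<close>
    obtain u v where uv: "(u, v) \<in> feasible X Z A B c" using \<open>feasible X Z A B c \<noteq> {}\<close> by auto
    have "\<rho> / 2 * constraint_regret A B c x z T
        = (\<Sum>t = 1..T. \<rho> / 2 * ((norm (A *v x (t + 1) + B *v z (t + 1) - c))\<^sup>2
            + (norm (B *v z (t + 1) - B *v z t))\<^sup>2))"
      by (simp add: constraint_regret_def sum_distrib_left)
    also have "\<dots> \<le> (\<Sum>t = 1..T. V u v t - V u v (t + 1) + F)"
    proof (rule sum_mono)
      fix t assume "t \<in> {1..T}"
      then have t: "t \<ge> 1" by simp
      define w where "w = A *v x (t + 1) + B *v z (t + 1) - c"
      define b where "b = B *v z (t + 1) - B *v z t"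
      \<comment> \<open>Optimality of \<open>z (t + 1)\<close> tested at \<open>z t\<close>, then of
        \<open>z t\<close> tested at \<open>z (t + 1)\<close>; adding the two eliminates
        \<open>G\<close>.\<close>
      have "G (z (t + 1)) - G (z t) \<le> - (y (t + 1) \<bullet> b)"
        using zopt[OF t zZ[OF t] zfin[OF t]]
        by (simp add: b_def matrix_vector_mult_diff_distrib inner_diff_right)
      moreover have "G (z t) - G (z (t + 1)) \<le> y t \<bullet> b"
      proof (cases "t = 1")
        \<comment> \<open>\<open>z 1\<close> comes from no update; \<open>y 1 = 0\<close> and
          \<open>G (z 1) = 0\<close> give the inequality directly.\<close>
        case True
        then show ?thesis using Gnn G0 \<open>z 1 = 0\<close> \<open>y 1 = 0\<close> by simp
      next
        case False
        then show ?thesis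
          using zopt[of "t - 1" "z (t + 1)"] zZ[of "t + 1"] zfin[of "t + 1"] t
          by (simp add: b_def matrix_vector_mult_diff_distrib)
      qed
      moreover have "y (t + 1) \<bullet> b = y t \<bullet> b + \<rho> * (w \<bullet> b)"
        using yupd[OF t] by (simp add: w_def residual_def inner_add_left)
      ultimately have "\<rho> * (w \<bullet> b) \<le> 0" by linarith
      then have "w \<bullet> b \<le> 0" using pos by (simp add: mult_le_0_iff)
      \<comment> \<open>Expanding the square of \<open>w - b\<close>, the cross term has the
        favourable sign.\<close>
      moreover have "r t = w - b" by (simp add: r_def w_def b_def)
      ultimately have "(norm w)\<^sup>2 + (norm b)\<^sup>2 \<le> (norm (r t))\<^sup>2"
        by (simp add: power2_norm_eq_inner inner_diff_left inner_diff_right inner_commute)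
      then have "\<rho> / 2 * ((norm w)\<^sup>2 + (norm b)\<^sup>2) \<le> \<rho> / 2 * (norm (r t))\<^sup>2"
        using pos by (intro mult_left_mono) auto
      moreover have "f t (x (t + 1)) + G (z (t + 1)) - (f t u + G v) \<ge> - F"
        using assms(24)[OF t uv] G[OF zfin[of "t + 1"]] G[OF feasD(4)[OF uv]] by simp
      moreover have "\<eta> * ?Br (x (t + 1)) (x t) \<ge> 0" using pos Brnn[OF xX t] by simp
      ultimately show "\<rho> / 2 * ((norm (A *v x (t + 1) + B *v z (t + 1) - c))\<^sup>2
            + (norm (B *v z (t + 1) - B *v z t))\<^sup>2) \<le> V u v t - V u v (t + 1) + F"
        using step[OF t uv] unfolding w_def b_def by linarith
    qed
    also have "\<dots> \<le> C + real T * F"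
      using V_telescope[OF uv] by (simp add: sum.distrib)
    also have "\<dots> = \<rho> / 2 * (lambda_max B * D\<^sub>z\<^sup>2 + sqrt 2 * D\<^sub>x * G\<^sub>f / sqrt \<alpha> + 2 * F * sqrt (real T))"
    proof -
      have "real T * F = \<rho> / 2 * (2 * F * sqrt (real T))" by (simp add: \<open>\<rho> = _\<close>)
      then show ?thesis unfolding C_def \<eta>D \<open>\<rho> = _\<close> by (simp add: algebra_simps)
    qed
    finally have "constraint_regret A B c x z T
        \<le> lambda_max B * D\<^sub>z\<^sup>2 + sqrt 2 * D\<^sub>x * G\<^sub>f / sqrt \<alpha> + 2 * F * sqrt (real T)"
      using pos by simp
    \<comment> \<open>The argument gives the coefficient sqrt 2; the claimed one is twice
      that.\<close>
    also have "\<dots> \<le> lambda_max B * D\<^sub>z\<^sup>2 + 2 * sqrt 2 * D\<^sub>x * G\<^sub>f / sqrt \<alpha> + 2 * F * sqrt (real T)"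
      using \<open>G\<^sub>f > 0\<close> \<open>D\<^sub>x > 0\<close> \<open>\<alpha> > 0\<close>
      by (intro add_mono divide_right_mono mult_right_mono order_refl) auto
    finally show ?thesis .
  qed
  ultimately show ?thesis by blast
qed

end
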